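(* For every $i\in I$, define the equivalence relation $\equiv_i$ on $X_i$ by declaring two $i$-colours to be equivalent if and only if they are contained in the same orbit of $F_i$. Let $(\tau,\Delta')$ be an implosion of $\Delta$ with respect to the relations $\equiv_i$. Then the group $\mathcal U_\Delta(\mathbf F)^+$ stabilises the fibres of $\tau$; that is, $\tau(g\cdot c)=\tau(c)$ for all $g\in\mathcal U_\Delta(\mathbf F)^+$ and all chambers $c\in\Delta$.
   Context: Buildings. Let $I$ be a finite set and $M=(m_{ij})_{i,j\in I}$ a right-angled Coxeter matrix: $m_{ii}=1$ and $m_{ij}=m_{ji}\in\{2,\infty\}$ for $i\ne j$; let $W$ be the Coxeter group with generators $(s_i)_{i\in I}$. The diagram is the graph on $I$ in which $i,j$ are joined iff $m_{ij}=\infty$. A (right-angled) building $\Delta$ of type $M$ is viewed as a chamber system: a set of chambers with an equivalence relation $\sim_i$ ($i$-adjacency) for each $i\in I$, all classes having at least two elements, and a map $\delta:\Delta\times\Delta\to W$ such that for each reduced word $s_{i_1}\cdots s_{i_k}$, $\delta(c,d)=s_{i_1}\cdots s_{i_k}$ iff there is a gallery $c=c_0\sim_{i_1}c_1\sim_{i_2}\cdots\sim_{i_k}c_k=d$ (consecutive chambers distinct) of type $(i_1,\dots,i_k)$. An $i$-panel is an equivalence class of $\sim_i$; $\mathrm{Res}_i(\Delta)$ is the set of $i$-panels; $\mathrm{dist}_\Delta$ is gallery distance. $\mathrm{Aut}(\Delta)$ is the group of bijections of the chamber set preserving each $\sim_i$. $\Delta$ is semiregular with parameters $(q_i)_{i\in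 I}$ if every $i$-panel has the same (possibly infinite) cardinality $q_i\ge 2$; for any choice of cardinals $q_i\geq 2$ such a building exists and is unique up to isomorphism. Universal groups. For each $i\in I$ let $X_i$ be a set (of $i$-colours) with $|X_i|\ge 2$ and $F_i\le\mathrm{Sym}(X_i)$ an arbitrary permutation group; write $\mathbf F=(F_i)_{i\in I}$. Let $\Delta$ be the semiregular right-angled building of type $M$ with $q_i=|X_i|$. A legal colouring is a map $\lambda=(\lambda_i)_{i\in I}:\Delta\to\prod_{i\in I}X_i$ such that for every $i$-panel $\mathcal P$, $\lambda_i|_{\mathcal P}:\mathcal P\to X_i$ is a bijection and $\lambda_j|_{\mathcal P}$ is constant for all $j\ne i$. Fix a legal colouring $\lambda$. The local action of $g\in\mathrm{Aut}(\Delta)$ at an $i$-panel $\mathcal P$ is $\sigma_\lambda(g,\mathcal P)=\lambda_i|_{g\mathcal P}\circ g|_{\mathcal P}\circ(\lambda_i|_{\mathcal P})^{-1}\in\mathrm{Sym}(X_i)$. The universal group is $\mathcal U_\Delta(\mathbf F)=\mathcal U_\Delta^\lambda(\mathbf F)=\{g\in\mathrm{Aut}(\Delta)\mid \sigma_\lambda(g,\mathcal P)\in F_i\text{ for all }i\in I,\ \mathcal P\in\mathrm{Res}_i(\Delta)\}$, and $\mathcal U_\Delta(\mathbf F)^+$ is the subgroup generated by all chamber stabilisers in $\mathcal U_\Delta(\mathbf F)$. Implosions. Given equivalence relations $\equiv_i$ on $X_i$ ($i\in I$), let $I'=\{i\in I\mid\equiv_i\text{ is not the universal relation}\}$, let $\Delta'$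 be the semiregular right-angled building over $I'$ with diagram induced from that of $\Delta$ and parameters $|X_i/{\equiv_i}|$, $i\in I'$, equipped with a legal colouring $\lambda'$ with $i$-colour sets $X_i/{\equiv_i}$. An implosion of $\Delta$ with respect to the $\equiv_i$ is a pair $(\tau,\Delta')$ where $\tau:\Delta\to\Delta'$ is a surjective map on chambers with $\lambda'_i(\tau(c))=[\lambda_i(c)]_i$ for all $c\in\Delta$, $i\in I'$, and $\mathrm{dist}_{\Delta'}(\tau(c_1),\tau(c_2))\le\mathrm{dist}_\Delta(c_1,c_2)$ for all $c_1,c_2\in\Delta$. *)

theory Defs
  imports
    "HOL-Algebra.Bij"
    "HOL-Algebra.Generated_Groups"
    "HOL-Algebra.Group_Action"
    "HOL-Library.Extended_Nat"
    "HOL-Library.Equipollence"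
begin

text \<open>
  Index sets are sets \<open>I :: 'i set\<close>, since the building \<open>\<Delta>'\<close> of an implosion lives over a
  subset \<open>I'\<close> of \<open>I\<close>. A Coxeter matrix is a function \<open>M :: 'i \<Rightarrow> 'i \<Rightarrow> enat\<close> of which
  only the values on \<open>I\<close> matter; restricting the diagram to \<open>I'\<close> thus keeps \<open>M\<close> and
  replaces \<open>I\<close> by \<open>I'\<close>.
\<close>

section \<open>Right-angled Coxeter groups\<close>

definition right_angled_matrix :: "'i set \<Rightarrow> ('i \<Rightarrow> 'i \<Rightarrow> enat) \<Rightarrow> bool" where
  "right_angled_matrix I M \<longleftrightarrow>
     (\<forall>i\<in>I. M i i = 1) \<and>
     (\<forall>i\<in>I. \<forall>j\<in>I. i \<noteq> j \<longrightarrow> M i j = M j i \<and> M i j \<in> {2, \<infinity>})"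

text \<open>
  The Coxeter group is presented by generators \<open>I\<close> and relators \<open>(i j)\<^sup>m\<close> with
  \<open>m = M i j\<close> finite. As \<open>M i i = 1\<close> makes every generator an involution, the
  monoid presentation already yields the group.
\<close>

inductive_set coxeter_cong :: "'i set \<Rightarrow> ('i \<Rightarrow> 'i \<Rightarrow> enat) \<Rightarrow> 'i list rel"
  for I :: "'i set" and M :: "'i \<Rightarrow> 'i \<Rightarrow> enat" where
  relator: "i \<in> I \<Longrightarrow> j \<in> I \<Longrightarrow> M i j = enat m \<Longrightarrow>
     (concat (replicate m [i, j]), []) \<in> coxeter_cong I M"
| refl: "u \<in> lists I \<Longrightarrow> (u, u) \<in> coxeter_cong I M"
| sym: "(u, v) \<in> coxeter_cong I M \<Longrightarrow> (v, u) \<in> coxeter_cong I M"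
| trans: "(u, v) \<in> coxeter_cong I M \<Longrightarrow> (v, w) \<in> coxeter_cong I M \<Longrightarrow>
     (u, w) \<in> coxeter_cong I M"
| ctxt: "(u, v) \<in> coxeter_cong I M \<Longrightarrow> a \<in> lists I \<Longrightarrow> b \<in> lists I \<Longrightarrow>
     (a @ u @ b, a @ v @ b) \<in> coxeter_cong I M"

text \<open>The element \<open>s\<^sub>i\<^sub>1 \<cdots> s\<^sub>i\<^sub>k\<close> represented by the word \<open>[i\<^sub>1, \<dots>, i\<^sub>k]\<close>.\<close>

definition word_elem :: "'i set \<Rightarrow> ('i \<Rightarrow> 'i \<Rightarrow> enat) \<Rightarrow> 'i list \<Rightarrow> 'i list set" where
  "word_elem I M w = coxeter_cong I M `` {w}"

definition coxeter_group :: "'i set \<Rightarrow> ('i \<Rightarrow> 'i \<Rightarrow> enat) \<Rightarrow> 'i list set monoid" where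
  "coxeter_group I M =
     \<lparr>carrier = lists I // coxeter_cong I M,
      mult = (\<lambda>A B. \<Union>a\<in>A. \<Union>b\<in>B. word_elem I M (a @ b)),
      one = word_elem I M []\<rparr>"

definition reduced_word :: "'i set \<Rightarrow> ('i \<Rightarrow> 'i \<Rightarrow> enat) \<Rightarrow> 'i list \<Rightarrow> bool" where
  "reduced_word I M w \<longleftrightarrow> w \<in> lists I \<and>
     (\<forall>v\<in>lists I. word_elem I M v = word_elem I M w \<longrightarrow> length w \<le> length v)"

lemma coxeter_cong_lists:
  "(u, v) \<in> coxeter_cong I M \<Longrightarrow> u \<in> lists I \<and> v \<in> lists I"
  by (induction rule: coxeter_cong.induct) (auto simp: in_lists_conv_set split: if_splits)

lemma equiv_coxeter_cong: "equiv (lists I) (coxeter_cong I M)"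
proof (rule equivI)
  show "coxeter_cong I M \<subseteq> lists I \<times> lists I"
    using coxeter_cong_lists by fast
  show "refl_on (lists I) (coxeter_cong I M)"
    by (rule refl_onI) (rule coxeter_cong.refl)
  show "sym (coxeter_cong I M)" by (rule symI) (rule coxeter_cong.sym)
  show "trans (coxeter_cong I M)" by (rule transI) (rule coxeter_cong.trans)
qed

lemma word_elem_eq_iff:
  "u \<in> lists I \<Longrightarrow> v \<in> lists I \<Longrightarrow>
     word_elem I M u = word_elem I M v \<longleftrightarrow> (u, v) \<in> coxeter_cong I M"
  unfolding word_elem_def by (rule eq_equiv_class_iff[OF equiv_coxeter_cong])

lemma coxeter_cong_append:
  assumes "(u, u') \<in> coxeter_cong I M" "(v, v') \<in> coxeter_cong I M"
  shows "(u @ v, u' @ v') \<in> coxeter_cong I M"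
proof -
  have "u' \<in> lists I" "v \<in> lists I" using assms coxeter_cong_lists by blast+
  then have "(u @ v, u' @ v) \<in> coxeter_cong I M" "(u' @ v, u' @ v') \<in> coxeter_cong I M"
    using coxeter_cong.ctxt[OF assms(1), of "[]" v] coxeter_cong.ctxt[OF assms(2), of u' "[]"]
    by auto
  then show ?thesis by (rule coxeter_cong.trans)
qed

lemma coxeter_mult_word:
  assumes "u \<in> lists I" "v \<in> lists I"
  shows "word_elem I M u \<otimes>\<^bsub>coxeter_group I M\<^esub> word_elem I M v = word_elem I M (u @ v)"
proof -
  have *: "word_elem I M (a @ b) = word_elem I M (u @ v)"
    if "a \<in> word_elem I M u" "b \<in> word_elem I M v" for a b
  proof -
    have "(u, a) \<in> coxeter_cong I M" "(v, b) \<in> coxeter_cong I M"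
      using that by (auto simp: word_elem_def)
    then have uv: "(u @ v, a @ b) \<in> coxeter_cong I M" by (rule coxeter_cong_append)
    show ?thesis
      using uv unfolding word_elem_def
      by (rule equiv_class_eq[OF equiv_coxeter_cong, symmetric])
  qed
  have "u \<in> word_elem I M u" "v \<in> word_elem I M v"
    using assms by (auto simp: word_elem_def intro: coxeter_cong.refl)
  then have "(\<Union>a\<in>word_elem I M u. \<Union>b\<in>word_elem I M v. word_elem I M (a @ b)) =
      (\<Union>a\<in>word_elem I M u. \<Union>b\<in>word_elem I M v. word_elem I M (u @ v))"
    by (intro SUP_cong HOL.refl *)
  also have "\<dots> = word_elem I M (u @ v)"
    using \<open>u \<in> word_elem I M u\<close> \<open>v \<in> word_elem I M v\<close> by blast
  finally show ?thesis by (simp add: coxeter_group_def)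
qed

lemma carrier_coxeter_group: "carrier (coxeter_group I M) = word_elem I M ` lists I"
  by (auto simp: coxeter_group_def word_elem_def quotient_def)

lemma coxeter_cong_rev:
  assumes "right_angled_matrix I M" "u \<in> lists I"
  shows "(rev u @ u, []) \<in> coxeter_cong I M"
  using assms(2)
proof (induction u)
  case Nil
  show ?case by (simp add: coxeter_cong.refl)
next
  case (Cons i u)
  have "M i i = enat 1" using Cons.hyps assms(1) by (auto simp: right_angled_matrix_def one_enat_def)
  then have "([i, i], []) \<in> coxeter_cong I M"
    using coxeter_cong.relator[of i I i M 1] Cons.hyps by simp
  moreover have "rev u \<in> lists I" "u \<in> lists I" using Cons.hyps by auto
  ultimately have "(rev u @ [i, i] @ u, rev u @ [] @ u) \<in> coxeter_cong I M"
    by (rule coxeter_cong.ctxt)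
  then have "(rev (i # u) @ i # u, rev u @ u) \<in> coxeter_cong I M" by simp
  then show ?case using Cons.IH by (rule coxeter_cong.trans)
qed

lemma group_coxeter_group:
  assumes "right_angled_matrix I M"
  shows "group (coxeter_group I M)"
proof -
  let ?G = "coxeter_group I M"
  have one: "\<one>\<^bsub>?G\<^esub> = word_elem I M []"
    by (simp add: coxeter_group_def)
  have mem: "word_elem I M u \<in> carrier ?G" if "u \<in> lists I" for u
    using that unfolding carrier_coxeter_group by (rule imageI)
  have rep: "\<exists>u\<in>lists I. x = word_elem I M u" if "x \<in> carrier ?G" for x
    using that unfolding carrier_coxeter_group by (simp only: image_iff)
  have app: "u @ v \<in> lists I" if "u \<in> lists I" "v \<in> lists I" for u v :: "'a list"
    using that by (simp only: append_in_lists_conv)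
  show ?thesis
  proof (rule groupI)
    show "\<one>\<^bsub>?G\<^esub> \<in> carrier ?G"
      unfolding one by (rule mem) (rule lists.Nil)
  next
    fix x y assume "x \<in> carrier ?G" "y \<in> carrier ?G"
    then obtain u v where u: "u \<in> lists I" "x = word_elem I M u"
      and v: "v \<in> lists I" "y = word_elem I M v" by (meson rep)
    show "x \<otimes>\<^bsub>?G\<^esub> y \<in> carrier ?G"
      unfolding u(2) v(2) coxeter_mult_word[OF u(1) v(1)] by (rule mem[OF app[OF u(1) v(1)]])
  next
    fix x y z assume "x \<in> carrier ?G" "y \<in> carrier ?G" "z \<in> carrier ?G"
    then obtain u v w where u: "u \<in> lists I" "x = word_elem I M u"
      and v: "v \<in> lists I" "y = word_elem I M v"
      and w: "w \<in> lists I" "z = word_elem I M w" by (meson rep)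
    show "x \<otimes>\<^bsub>?G\<^esub> y \<otimes>\<^bsub>?G\<^esub> z = x \<otimes>\<^bsub>?G\<^esub> (y \<otimes>\<^bsub>?G\<^esub> z)"
      unfolding u(2) v(2) w(2) coxeter_mult_word[OF u(1) v(1)] coxeter_mult_word[OF v(1) w(1)]
        coxeter_mult_word[OF app[OF u(1) v(1)] w(1)] coxeter_mult_word[OF u(1) app[OF v(1) w(1)]]
      by (simp only: append_assoc)
  next
    fix x assume "x \<in> carrier ?G"
    then obtain u where u: "u \<in> lists I" "x = word_elem I M u" by (meson rep)
    show "\<one>\<^bsub>?G\<^esub> \<otimes>\<^bsub>?G\<^esub> x = x"
      unfolding u(2) one coxeter_mult_word[OF lists.Nil u(1)] by (simp only: append_Nil)
    have ru: "rev u \<in> lists I"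
      using u(1) by (simp only: in_lists_conv_set set_rev)
    have "word_elem I M (rev u) \<otimes>\<^bsub>?G\<^esub> x = \<one>\<^bsub>?G\<^esub>"
      unfolding u(2) one coxeter_mult_word[OF ru u(1)]
        word_elem_eq_iff[OF app[OF ru u(1)] lists.Nil]
      by (rule coxeter_cong_rev[OF assms u(1)])
    then show "\<exists>y\<in>carrier ?G. y \<otimes>\<^bsub>?G\<^esub> x = \<one>\<^bsub>?G\<^esub>"
      using mem[OF ru] by (rule bexI)
  qed
qed

section \<open>Right-angled buildings\<close>

record ('i, 'c) chamber_system =
  chambers :: "'c set"
  adj :: "'i \<Rightarrow> 'c rel"
  weyl_dist :: "'c \<Rightarrow> 'c \<Rightarrow> 'i list set"

definition panels :: "('i, 'c) chamber_system \<Rightarrow> 'i \<Rightarrow> 'c set set" where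
  "panels \<Delta> i = chambers \<Delta> // adj \<Delta> i"

definition gallery :: "('i, 'c) chamber_system \<Rightarrow> 'i list \<Rightarrow> 'c list \<Rightarrow> bool" where
  "gallery \<Delta> w cs \<longleftrightarrow> cs \<in> lists (chambers \<Delta>) \<and> length cs = Suc (length w) \<and>
     (\<forall>k<length w. (cs ! k, cs ! Suc k) \<in> adj \<Delta> (w ! k) \<and> cs ! k \<noteq> cs ! Suc k)"

definition gallery_between ::
  "('i, 'c) chamber_system \<Rightarrow> 'i list \<Rightarrow> 'c \<Rightarrow> 'c \<Rightarrow> bool" where
  "gallery_between \<Delta> w c d \<longleftrightarrow> (\<exists>cs. gallery \<Delta> w cs \<and> hd cs = c \<and> last cs = d)"

text \<open>Only used for buildings, where any two chambers are joined by a gallery.\<close>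

definition gallery_dist :: "'i set \<Rightarrow> ('i, 'c) chamber_system \<Rightarrow> 'c \<Rightarrow> 'c \<Rightarrow> nat" where
  "gallery_dist I \<Delta> c d = (LEAST n. \<exists>w\<in>lists I. length w = n \<and> gallery_between \<Delta> w c d)"

definition right_angled_building ::
  "'i set \<Rightarrow> ('i \<Rightarrow> 'i \<Rightarrow> enat) \<Rightarrow> ('i, 'c) chamber_system \<Rightarrow> bool" where
  "right_angled_building I M \<Delta> \<longleftrightarrow>
     finite I \<and> right_angled_matrix I M \<and> chambers \<Delta> \<noteq> {} \<and>
     (\<forall>i\<in>I. equiv (chambers \<Delta>) (adj \<Delta> i) \<and>
        (\<forall>P\<in>panels \<Delta> i. \<exists>c\<in>P. \<exists>d\<in>P. c \<noteq> d)) \<and>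
     (\<forall>c\<in>chambers \<Delta>. \<forall>d\<in>chambers \<Delta>.
        weyl_dist \<Delta> c d \<in> carrier (coxeter_group I M) \<and>
        (\<forall>w. reduced_word I M w \<longrightarrow>
           (weyl_dist \<Delta> c d = word_elem I M w \<longleftrightarrow> gallery_between \<Delta> w c d)))"

text \<open>Cardinal parameters \<open>q\<^sub>i\<close> are given by sets \<open>X i\<close> of that cardinality.\<close>

definition semiregular :: "'i set \<Rightarrow> ('i, 'c) chamber_system \<Rightarrow> ('i \<Rightarrow> 'x set) \<Rightarrow> bool" where
  "semiregular I \<Delta> X \<longleftrightarrow> (\<forall>i\<in>I. \<forall>P\<in>panels \<Delta> i. P \<approx> X i)"

definition building_aut :: "'i set \<Rightarrow> ('i, 'c) chamber_system \<Rightarrow> ('c \<Rightarrow> 'c) set" where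
  "building_aut I \<Delta> = {g \<in> Bij (chambers \<Delta>).
     \<forall>i\<in>I. \<forall>c\<in>chambers \<Delta>. \<forall>d\<in>chambers \<Delta>. (g c, g d) \<in> adj \<Delta> i \<longleftrightarrow> (c, d) \<in> adj \<Delta> i}"

section \<open>Universal groups\<close>

definition legal_colouring ::
  "'i set \<Rightarrow> ('i, 'c) chamber_system \<Rightarrow> ('i \<Rightarrow> 'x set) \<Rightarrow> ('i \<Rightarrow> 'c \<Rightarrow> 'x) \<Rightarrow> bool" where
  "legal_colouring I \<Delta> X col \<longleftrightarrow>
     (\<forall>i\<in>I. col i \<in> chambers \<Delta> \<rightarrow> X i) \<and>
     (\<forall>i\<in>I. \<forall>P\<in>panels \<Delta> i. bij_betw (col i) P (X i) \<and>
        (\<forall>j\<in>I. j \<noteq> i \<longrightarrow> (\<forall>c\<in>P. \<forall>d\<in>P. col j c = col j d)))"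

definition local_action ::
  "('i \<Rightarrow> 'x set) \<Rightarrow> ('i \<Rightarrow> 'c \<Rightarrow> 'x) \<Rightarrow> ('c \<Rightarrow> 'c) \<Rightarrow> 'i \<Rightarrow> 'c set \<Rightarrow> 'x \<Rightarrow> 'x" where
  "local_action X col g i P = restrict (col i \<circ> g \<circ> inv_into P (col i)) (X i)"

definition universal_group ::
  "'i set \<Rightarrow> ('i, 'c) chamber_system \<Rightarrow> ('i \<Rightarrow> 'x set) \<Rightarrow> ('i \<Rightarrow> 'c \<Rightarrow> 'x) \<Rightarrow>
     ('i \<Rightarrow> ('x \<Rightarrow> 'x) set) \<Rightarrow> ('c \<Rightarrow> 'c) set" where
  "universal_group I \<Delta> X col F =
     {g \<in> building_aut I \<Delta>. \<forall>i\<in>I. \<forall>P\<in>panels \<Delta> i. local_action X col g i P \<in> F i}"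

definition universal_group_plus ::
  "'i set \<Rightarrow> ('i, 'c) chamber_system \<Rightarrow> ('i \<Rightarrow> 'x set) \<Rightarrow> ('i \<Rightarrow> 'c \<Rightarrow> 'x) \<Rightarrow>
     ('i \<Rightarrow> ('x \<Rightarrow> 'x) set) \<Rightarrow> ('c \<Rightarrow> 'c) set" where
  "universal_group_plus I \<Delta> X col F =
     generate (BijGroup (chambers \<Delta>))
       (\<Union>c\<in>chambers \<Delta>. {g \<in> universal_group I \<Delta> X col F. g c = c})"

section \<open>Implosions\<close>

definition nonuniversal :: "'i set \<Rightarrow> ('i \<Rightarrow> 'x set) \<Rightarrow> ('i \<Rightarrow> 'x rel) \<Rightarrow> 'i set" where
  "nonuniversal I X R = {i \<in> I. R i \<noteq> X i \<times> X i}"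

definition implosion ::
  "'i set \<Rightarrow> ('i \<Rightarrow> 'i \<Rightarrow> enat) \<Rightarrow> ('i, 'c) chamber_system \<Rightarrow> ('i \<Rightarrow> 'x set) \<Rightarrow>
     ('i \<Rightarrow> 'c \<Rightarrow> 'x) \<Rightarrow> ('i \<Rightarrow> 'x rel) \<Rightarrow> ('c \<Rightarrow> 'd) \<Rightarrow> ('i, 'd) chamber_system \<Rightarrow>
     ('i \<Rightarrow> 'd \<Rightarrow> 'x set) \<Rightarrow> bool" where
  "implosion I M \<Delta> X col R \<tau> \<Delta>' col' \<longleftrightarrow>
     (\<forall>i\<in>I. equiv (X i) (R i)) \<and>
     (let I' = nonuniversal I X R; X' = (\<lambda>i. X i // R i) in
        right_angled_building I' M \<Delta>' \<and>
        semiregular I' \<Delta>' X' \<and>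
        legal_colouring I' \<Delta>' X' col' \<and>
        \<tau> ` chambers \<Delta> = chambers \<Delta>' \<and>
        (\<forall>c\<in>chambers \<Delta>. \<forall>i\<in>I'. col' i (\<tau> c) = R i `` {col i c}) \<and>
        (\<forall>c\<in>chambers \<Delta>. \<forall>d\<in>chambers \<Delta>.
           gallery_dist I' \<Delta>' (\<tau> c) (\<tau> d) \<le> gallery_dist I \<Delta> c d))"

definition same_orbit :: "'x set \<Rightarrow> ('x \<Rightarrow> 'x) set \<Rightarrow> 'x rel" where
  "same_orbit S H =
     {(x, y). \<exists>B\<in>orbits (BijGroup S\<lparr>carrier := H\<rparr>) S (\<lambda>h. h). x \<in> B \<and> y \<in> B}"

lemma same_orbit_iff:
  "(x, y) \<in> same_orbit S H \<longleftrightarrow> (\<exists>z\<in>S. (\<exists>g\<in>H. x = g z) \<and> (\<exists>h\<in>H. y = h z))"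
  unfolding same_orbit_def orbits_def orbit_def by auto

lemma equiv_same_orbit:
  assumes "subgroup H (BijGroup S)"
  shows "equiv S (same_orbit S H)"
proof -
  let ?G = "BijGroup S\<lparr>carrier := H\<rparr>"
  interpret B: group "BijGroup S" by (rule group_BijGroup)
  have "group ?G" using assms by (rule subgroup.subgroup_is_group) (rule B.is_group)
  then have "group_hom ?G (BijGroup S) (\<lambda>h. h)"
    using subgroup.subset[OF assms]
    by (auto simp: group_hom_def group_hom_axioms_def hom_def B.is_group)
  then interpret group_action ?G S "\<lambda>h. h" by (rule group_action.intro)
  have incl: "B \<subseteq> S" if "B \<in> orbits ?G S (\<lambda>h. h)" for B
    using orbit_partition that by (rule partition.incl)
  show ?thesis
  proof (rule equivI)
    show "same_orbit S H \<subseteq> S \<times> S"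
    proof
      fix p assume "p \<in> same_orbit S H"
      then obtain B where B: "B \<in> orbits ?G S (\<lambda>h. h)" "fst p \<in> B" "snd p \<in> B"
        by (auto simp: same_orbit_def)
      then have "fst p \<in> S" "snd p \<in> S" using incl by blast+
      then show "p \<in> S \<times> S" by (simp add: mem_Times_iff)
    qed
    show "refl_on S (same_orbit S H)"
    proof (rule refl_onI)
      fix x assume "x \<in> S"
      then show "(x, x) \<in> same_orbit S H"
        using orbit_refl[of x] by (auto simp: same_orbit_def orbits_def)
    qed
    show "sym (same_orbit S H)" by (auto simp: sym_def same_orbit_def)
    show "trans (same_orbit S H)"
    proof (rule transI)
      fix x y z assume "(x, y) \<in> same_orbit S H" "(y, z) \<in> same_orbit S H"
      then obtain B C where B: "B \<in> orbits ?G S (\<lambda>h. h)" "x \<in> B" "y \<in> B"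
        and C: "C \<in> orbits ?G S (\<lambda>h. h)" "y \<in> C" "z \<in> C"
        by (auto simp: same_orbit_def)
      with disjoint_union[OF B(1) C(1)] have "B = C" by blast
      with B C show "(x, z) \<in> same_orbit S H" by (auto simp: same_orbit_def)
    qed
  qed
qed

end

theory Submission
  imports Defs
begin

text \<open>
  The implosion \<open>\<tau>\<close> does not increase distances, so it sends \<open>i\<close>-adjacent chambers to
  chambers that are equal or adjacent. The colours decide which: an \<open>i\<close>-step leaves every
  \<open>j\<close>-colour with \<open>j \<noteq> i\<close> alone, whereas a proper \<open>j\<close>-step in \<open>\<Delta>'\<close> changes the
  \<open>j\<close>-colour. Hence the image of an \<open>i\<close>-step from \<open>c\<close> to \<open>d\<close> stays in one \<open>i\<close>-panel (and is
  constant if \<open>i\<close> has been collapsed), and as colours are injective on panels, \<open>\<tau> d\<close> depends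
  only on \<open>\<tau> c\<close> and on the class of the \<open>i\<close>-colour of \<open>d\<close>
  (\<open>implosion_step_determined\<close>).

  Now let \<open>g\<close> in the universal group fix a chamber \<open>c\<close>. Local actions lie in the \<open>F i\<close>, so
  \<open>g\<close> moves every \<open>i\<close>-colour inside its \<open>F i\<close>-orbit (\<open>universal_group_same_orbit\<close>). A
  gallery starting at \<open>c\<close> and its image under \<open>g\<close> therefore start at the same chamber and have
  the same type and the same sequence of colour classes, so that \<open>\<tau>\<close> identifies them
  chamber by chamber. Since every chamber is reached by such a gallery, \<open>g\<close> preserves the fibres
  of \<open>\<tau>\<close>; this property passes to products and inverses, hence to the subgroup generated by
  all chamber stabilisers.
\<close>

section \<open>Galleries and adjacency in buildings\<close>

text \<open>
  Every element of the Coxeter group has a shortest representative, and for reduced words the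
  Weyl distance guarantees a gallery.
\<close>

lemma building_gallery:
  assumes B: "right_angled_building I M \<Delta>" and c: "c \<in> chambers \<Delta>" and d: "d \<in> chambers \<Delta>"
  shows "\<exists>w\<in>lists I. gallery_between \<Delta> w c d"
proof -
  have "weyl_dist \<Delta> c d \<in> carrier (coxeter_group I M)"
    using B c d unfolding right_angled_building_def by blast
  then obtain u where u: "u \<in> lists I" "weyl_dist \<Delta> c d = word_elem I M u"
    unfolding carrier_coxeter_group by blast
  obtain w where w: "w \<in> lists I" "word_elem I M w = word_elem I M u"
    and min: "\<And>v. v \<in> lists I \<Longrightarrow> word_elem I M v = word_elem I M u \<Longrightarrow> length w \<le> length v"
    using ex_has_least_nat[of "\<lambda>v. v \<in> lists I \<and> word_elem I M v = word_elem I M u" u length] u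
    by blast
  have "reduced_word I M w"
    using w min unfolding reduced_word_def by simp
  then have "gallery_between \<Delta> w c d"
    using B c d u w unfolding right_angled_building_def by metis
  then show ?thesis using w by blast
qed

lemma building_connected:
  assumes B: "right_angled_building I M \<Delta>" and c: "c \<in> chambers \<Delta>" and d: "d \<in> chambers \<Delta>"
  shows "(c, d) \<in> (\<Union>i\<in>I. adj \<Delta> i)\<^sup>*"
proof -
  let ?A = "\<Union>i\<in>I. adj \<Delta> i"
  obtain w cs where w: "w \<in> lists I" and cs: "gallery \<Delta> w cs" and ends: "hd cs = c" "last cs = d"
    using building_gallery[OF B c d] unfolding gallery_between_def by blast
  have len: "length cs = Suc (length w)"
    using cs unfolding gallery_def by blast
  have "(cs ! 0, cs ! k) \<in> ?A\<^sup>*" if "k \<le> length w" for k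
    using that
  proof (induction k)
    case (Suc k)
    then have "w ! k \<in> I" "(cs ! k, cs ! Suc k) \<in> adj \<Delta> (w ! k)"
      using w cs unfolding gallery_def by (auto simp: in_lists_conv_set)
    then have "(cs ! k, cs ! Suc k) \<in> ?A" by blast
    moreover have "(cs ! 0, cs ! k) \<in> ?A\<^sup>*" using Suc by simp
    ultimately show ?case by (meson rtrancl_into_rtrancl)
  qed simp
  then have "(cs ! 0, cs ! length w) \<in> ?A\<^sup>*" by simp
  moreover have "cs ! 0 = c" "cs ! length w = d"
    using ends len hd_conv_nth[of cs] last_conv_nth[of cs] by force+
  ultimately show ?thesis by simp
qed

lemma building_equiv_adj:
  "right_angled_building I M \<Delta> \<Longrightarrow> i \<in> I \<Longrightarrow> equiv (chambers \<Delta>) (adj \<Delta> i)"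
  unfolding right_angled_building_def by blast

lemma building_adj_chambers:
  assumes "right_angled_building I M \<Delta>" "i \<in> I" "(c, d) \<in> adj \<Delta> i"
  shows "c \<in> chambers \<Delta>" "d \<in> chambers \<Delta>"
  using building_equiv_adj[OF assms(1,2)] assms(3) unfolding equiv_def by blast+

lemma building_adj_panel:
  assumes B: "right_angled_building I M \<Delta>" and i: "i \<in> I" and cd: "(c, d) \<in> adj \<Delta> i"
  obtains P where "P \<in> panels \<Delta> i" "c \<in> P" "d \<in> P"
proof
  note eq = building_equiv_adj[OF B i]
  note ch = building_adj_chambers[OF B i cd]
  show "adj \<Delta> i `` {c} \<in> panels \<Delta> i" using ch unfolding panels_def by (simp add: quotientI)
  show "c \<in> adj \<Delta> i `` {c}" using eq ch(1) by (rule equiv_class_self)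
  show "d \<in> adj \<Delta> i `` {c}" using cd by simp
qed

lemma gallery_dist_adj_le:
  assumes B: "right_angled_building I M \<Delta>" and i: "i \<in> I" and cd: "(c, d) \<in> adj \<Delta> i"
  shows "gallery_dist I \<Delta> c d \<le> 1"
proof (cases "c = d")
  case True
  have "gallery \<Delta> [] [c]"
    using building_adj_chambers[OF B i cd] by (simp add: gallery_def)
  then have "\<exists>w\<in>lists I. length w = 0 \<and> gallery_between \<Delta> w c d"
    using True unfolding gallery_between_def by force
  then have "gallery_dist I \<Delta> c d \<le> 0" unfolding gallery_dist_def by (rule Least_le)
  then show ?thesis by simp
next
  case False
  have "gallery \<Delta> [i] [c, d]"
    using building_adj_chambers[OF B i cd] cd False by (simp add: gallery_def)
  then have "gallery_between \<Delta> [i] c d"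
    unfolding gallery_between_def by force
  then have "\<exists>w\<in>lists I. length w = 1 \<and> gallery_between \<Delta> w c d"
    using i by (intro bexI[of _ "[i]"]) auto
  then show ?thesis unfolding gallery_dist_def by (rule Least_le)
qed

lemma gallery_dist_le_1_cases:
  assumes B: "right_angled_building I M \<Delta>" and c: "c \<in> chambers \<Delta>" and d: "d \<in> chambers \<Delta>"
    and dist: "gallery_dist I \<Delta> c d \<le> 1"
  obtains "c = d" | j where "j \<in> I" "(c, d) \<in> adj \<Delta> j" "c \<noteq> d"
proof -
  have "\<exists>n. \<exists>w\<in>lists I. length w = n \<and> gallery_between \<Delta> w c d"
    using building_gallery[OF B c d] by blast
  then have "\<exists>w\<in>lists I. length w = gallery_dist I \<Delta> c d \<and> gallery_between \<Delta> w c d"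
    unfolding gallery_dist_def by (rule LeastI_ex)
  then obtain w cs where w: "w \<in> lists I" "length w \<le> 1"
    and cs: "gallery \<Delta> w cs" "hd cs = c" "last cs = d"
    using dist unfolding gallery_between_def by metis
  show thesis
  proof (cases w)
    case Nil
    then have "c = d" using cs by (auto simp: gallery_def length_Suc_conv)
    then show thesis by (rule that(1))
  next
    case (Cons j v)
    then have "w = [j]" using w by simp
    then have "j \<in> I" "(c, d) \<in> adj \<Delta> j" "c \<noteq> d"
      using w cs by (auto simp: gallery_def length_Suc_conv)
    then show thesis by (rule that(2))
  qed
qed

section \<open>Colours along panels\<close>

lemma legal_colouring_inj:
  assumes "right_angled_building I M \<Delta>" "legal_colouring I \<Delta> X col"
    and "i \<in> I" "(c, d) \<in> adj \<Delta> i" "col i c = col i d"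
  shows "c = d"
proof -
  obtain P where P: "P \<in> panels \<Delta> i" "c \<in> P" "d \<in> P"
    using building_adj_panel assms by metis
  then have "inj_on (col i) P"
    using assms unfolding legal_colouring_def bij_betw_def by blast
  then show ?thesis using P assms(5) by (meson inj_onD)
qed

lemma legal_colouring_const:
  assumes "right_angled_building I M \<Delta>" "legal_colouring I \<Delta> X col"
    and "i \<in> I" "(c, d) \<in> adj \<Delta> i" "j \<in> I" "j \<noteq> i"
  shows "col j c = col j d"
proof -
  obtain P where "P \<in> panels \<Delta> i" "c \<in> P" "d \<in> P"
    using building_adj_panel assms by metis
  then show ?thesis using assms unfolding legal_colouring_def by blast
qed

section \<open>Images of adjacent chambers under an implosion\<close>

lemma implosionD:
  assumes "implosion I M \<Delta> X col R \<tau> \<Delta>' col'"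
  shows "i \<in> I \<Longrightarrow> equiv (X i) (R i)"
    and "right_angled_building (nonuniversal I X R) M \<Delta>'"
    and "legal_colouring (nonuniversal I X R) \<Delta>' (\<lambda>i. X i // R i) col'"
    and "\<tau> ` chambers \<Delta> = chambers \<Delta>'"
    and "c \<in> chambers \<Delta> \<Longrightarrow> i \<in> nonuniversal I X R \<Longrightarrow> col' i (\<tau> c) = R i `` {col i c}"
    and "c \<in> chambers \<Delta> \<Longrightarrow> d \<in> chambers \<Delta> \<Longrightarrow>
      gallery_dist (nonuniversal I X R) \<Delta>' (\<tau> c) (\<tau> d) \<le> gallery_dist I \<Delta> c d"
  using assms unfolding implosion_def Let_def by blast+

text \<open>
  The images are at distance at most one. A proper \<open>j\<close>-step between them would change the
  \<open>j\<close>-colour, which an \<open>i\<close>-step upstairs can only do for \<open>j = i\<close>.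
\<close>

lemma implosion_adj:
  assumes B: "right_angled_building I M \<Delta>" and L: "legal_colouring I \<Delta> X col"
    and T: "implosion I M \<Delta> X col R \<tau> \<Delta>' col'"
    and i: "i \<in> I" and cd: "(c, d) \<in> adj \<Delta> i"
  shows "\<tau> c = \<tau> d \<or> i \<in> nonuniversal I X R \<and> (\<tau> c, \<tau> d) \<in> adj \<Delta>' i"
proof -
  let ?J = "nonuniversal I X R"
  note B' = implosionD(2)[OF T] and L' = implosionD(3)[OF T]
  note ch = building_adj_chambers[OF B i cd]
  then have ch': "\<tau> c \<in> chambers \<Delta>'" "\<tau> d \<in> chambers \<Delta>'" using implosionD(4)[OF T] by blast+
  have "gallery_dist ?J \<Delta>' (\<tau> c) (\<tau> d) \<le> 1"
    using implosionD(6)[OF T ch] gallery_dist_adj_le[OF B i cd] by (rule order_trans)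
  with B' ch' show ?thesis
  proof (cases rule: gallery_dist_le_1_cases)
    case (2 j)
    have "j = i"
    proof (rule ccontr)
      assume "j \<noteq> i"
      moreover have "j \<in> I" using 2 by (simp add: nonuniversal_def)
      ultimately have "col j c = col j d"
        using legal_colouring_const[OF B L i cd] by blast
      then have "col' j (\<tau> c) = col' j (\<tau> d)"
        using implosionD(5)[OF T] ch 2(1) by metis
      then show False using legal_colouring_inj[OF B' L' 2(1,2)] 2(3) by blast
    qed
    then show ?thesis using 2 by blast
  qed blast
qed

text \<open>
  The implosion of an \<open>i\<close>-step is known once its starting point and the class of the final
  \<open>i\<close>-colour are: two such steps out of one fibre end in the same \<open>i\<close>-panel with the same
  \<open>i\<close>-colour.
\<close>

lemma implosion_step_determined:
  assumes B: "right_angled_building I M \<Delta>" and L: "legal_colouring I \<Delta> X col"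
    and T: "implosion I M \<Delta> X col R \<tau> \<Delta>' col'"
    and i: "i \<in> I" and cd: "(c, d) \<in> adj \<Delta> i" and cd': "(c', d') \<in> adj \<Delta> i"
    and start: "\<tau> c = \<tau> c'" and colours: "(col i d, col i d') \<in> R i"
  shows "\<tau> d = \<tau> d'"
proof (cases "i \<in> nonuniversal I X R")
  case False
  then show ?thesis using implosion_adj[OF B L T i] cd cd' start by metis
next
  case True
  note B' = implosionD(2)[OF T] and L' = implosionD(3)[OF T]
  note ch = building_adj_chambers[OF B i cd] building_adj_chambers[OF B i cd']
  have ch': "\<tau> c \<in> chambers \<Delta>'" using ch implosionD(4)[OF T] by blast
  note eq' = building_equiv_adj[OF B' True]
  then have "(\<tau> c, \<tau> c) \<in> adj \<Delta>' i" using ch' unfolding equiv_def by (meson refl_onD)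
  then have "(\<tau> c, \<tau> d) \<in> adj \<Delta>' i" "(\<tau> c, \<tau> d') \<in> adj \<Delta>' i"
    using implosion_adj[OF B L T i cd] implosion_adj[OF B L T i cd'] start by auto
  then have "(\<tau> d, \<tau> d') \<in> adj \<Delta>' i"
    using eq' unfolding equiv_def by (meson symD transD)
  moreover have "col' i (\<tau> d) = col' i (\<tau> d')"
    using implosionD(5)[OF T _ True] ch equiv_class_eq[OF implosionD(1)[OF T i] colours] by simp
  ultimately show ?thesis by (rule legal_colouring_inj[OF B' L' True])
qed

section \<open>Universal groups and the fibres of an implosion\<close>

lemma universal_group_same_orbit:
  assumes B: "right_angled_building I M \<Delta>" and L: "legal_colouring I \<Delta> X col"
    and H: "subgroup (F i) (BijGroup (X i))"
    and g: "g \<in> universal_group I \<Delta> X col F" and i: "i \<in> I" and d: "d \<in> chambers \<Delta>"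
  shows "(col i d, col i (g d)) \<in> same_orbit (X i) (F i)"
proof -
  have "(d, d) \<in> adj \<Delta> i" using building_equiv_adj[OF B i] d unfolding equiv_def
    by (meson refl_onD)
  then obtain P where P: "P \<in> panels \<Delta> i" "d \<in> P" by (rule building_adj_panel[OF B i])
  let ?s = "local_action X col g i P"
  have s: "?s \<in> F i" using g i P unfolding universal_group_def by blast
  have X: "col i d \<in> X i" using L i d unfolding legal_colouring_def by blast
  have "inj_on (col i) P" using L i P unfolding legal_colouring_def bij_betw_def by blast
  then have "?s (col i d) = col i (g d)"
    using P X by (simp add: local_action_def)
  moreover have "\<one>\<^bsub>BijGroup (X i)\<^esub> \<in> F i" using H by (rule subgroup.one_closed)
  moreover have "\<one>\<^bsub>BijGroup (X i)\<^esub> (col i d) = col i d" using X by (simp add: BijGroup_def)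
  ultimately show ?thesis using s X unfolding same_orbit_iff by metis
qed

text \<open>
  Following a gallery from the fixed chamber \<open>c\<close> to \<open>d\<close> and its image under \<open>g\<close>: at each step
  the two galleries are in the same fibre and continue with the same type and equivalent colours.
\<close>

lemma chamber_stabiliser_preserves_fibres:
  assumes B: "right_angled_building I M \<Delta>" and L: "legal_colouring I \<Delta> X col"
    and H: "\<forall>i\<in>I. subgroup (F i) (BijGroup (X i))"
    and T: "implosion I M \<Delta> X col (\<lambda>i. same_orbit (X i) (F i)) \<tau> \<Delta>' col'"
    and g: "g \<in> universal_group I \<Delta> X col F" and c: "c \<in> chambers \<Delta>" "g c = c"
    and d: "d \<in> chambers \<Delta>"
  shows "\<tau> (g d) = \<tau> d"
  using building_connected[OF B c(1) d]
proof (induction rule: rtrancl_induct)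
  case base
  show ?case using c by simp
next
  case (step y z)
  then obtain i where i: "i \<in> I" "(y, z) \<in> adj \<Delta> i" by blast
  note ch = building_adj_chambers[OF B i]
  have "(g y, g z) \<in> adj \<Delta> i"
    using g i ch unfolding universal_group_def building_aut_def by blast
  moreover have "(col i z, col i (g z)) \<in> same_orbit (X i) (F i)"
    using universal_group_same_orbit[OF B L _ g i(1) ch(2)] H i by blast
  ultimately have "\<tau> z = \<tau> (g z)"
    using implosion_step_determined[OF B L T i(1) i(2)] step.IH by metis
  then show ?case by simp
qed

text \<open>The bijections of \<open>S\<close> that preserve the fibres of \<open>f\<close> form a group.\<close>

lemma generate_preserves_fibres:
  assumes K: "K \<subseteq> Bij S" and fib: "\<And>h x. h \<in> K \<Longrightarrow> x \<in> S \<Longrightarrow> f (h x) = f x"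
    and g: "g \<in> generate (BijGroup S) K"
  shows "\<forall>x\<in>S. f (g x) = f x"
proof -
  interpret group "BijGroup S" by (rule group_BijGroup)
  have KS: "K \<subseteq> carrier (BijGroup S)" using K by (simp add: BijGroup_def)
  show ?thesis
    using g
  proof (induction rule: generate.induct)
    case one
    show ?case by (simp add: BijGroup_def)
  next
    case (incl h)
    then show ?case using fib by blast
  next
    case (inv h)
    then have h: "h \<in> Bij S" using K by blast
    then have surj: "h ` S = S" by (simp add: Bij_def bij_betw_def)
    have "f (inv_into S h x) = f x" if "x \<in> S" for x
      using fib[OF inv, of "inv_into S h x"] that surj
      by (simp add: f_inv_into_f inv_into_into)
    then show ?case using h by (simp add: inv_BijGroup)
  next
    case (eng h1 h2)
    have "h1 \<in> carrier (BijGroup S)" "h2 \<in> carrier (BijGroup S)"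
      using eng.hyps by (auto intro: generate_in_carrier[OF KS])
    then have h: "h1 \<in> Bij S" "h2 \<in> Bij S" by (simp_all add: BijGroup_def)
    have "h2 x \<in> S" if "x \<in> S" for x
      using h(2) that unfolding Bij_def by (blast dest: bij_betwE)
    with h show ?case using eng.IH by (simp add: BijGroup_def compose_def)
  qed
qed

theorem proposition5p3:
  fixes I :: "'i set" and M :: "'i \<Rightarrow> 'i \<Rightarrow> enat"
    and X :: "'i \<Rightarrow> 'x set" and F :: "'i \<Rightarrow> ('x \<Rightarrow> 'x) set"
    and \<Delta> :: "('i, 'c) chamber_system" and col :: "'i \<Rightarrow> 'c \<Rightarrow> 'x"
    and \<tau> :: "'c \<Rightarrow> 'd" and \<Delta>' :: "('i, 'd) chamber_system" and col' :: "'i \<Rightarrow> 'd \<Rightarrow> 'x set"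
  assumes "right_angled_building I M \<Delta>"
    and "\<forall>i\<in>I. \<exists>x\<in>X i. \<exists>y\<in>X i. x \<noteq> y"
    and "\<forall>i\<in>I. subgroup (F i) (BijGroup (X i))"
    and "semiregular I \<Delta> X"
    and "legal_colouring I \<Delta> X col"
    and "implosion I M \<Delta> X col (\<lambda>i. same_orbit (X i) (F i)) \<tau> \<Delta>' col'"
  shows "\<forall>g\<in>universal_group_plus I \<Delta> X col F. \<forall>c\<in>chambers \<Delta>. \<tau> (g c) = \<tau> c"
proof
  fix g assume g: "g \<in> universal_group_plus I \<Delta> X col F"
  show "\<forall>c\<in>chambers \<Delta>. \<tau> (g c) = \<tau> c"
  proof (rule generate_preserves_fibres)
    let ?K = "\<Union>c\<in>chambers \<Delta>. {g \<in> universal_group I \<Delta> X col F. g c = c}"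
    show "g \<in> generate (BijGroup (chambers \<Delta>)) ?K"
      using g unfolding universal_group_plus_def .
    show "?K \<subseteq> Bij (chambers \<Delta>)"
      unfolding universal_group_def building_aut_def by blast
    show "\<tau> (h d) = \<tau> d" if "h \<in> ?K" "d \<in> chambers \<Delta>" for h d
      using that chamber_stabiliser_preserves_fibres[OF assms(1,5,3,6)] by blast
  qed
qed

end
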